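(* Let $q\ge 1$ and $p\ge 1$ be integers, let $\alpha_l$ ($-q+1\le l\le q$) and $\beta_l$ ($-q\le l\le q$) be real constants, and let $[\mathcal{D}_x]$ be the associated FD-FV operator $$[\mathcal{D}_xw]_{j+1/2}=\frac1h\sum_{l=-q+1}^{q}\alpha_l\,\overline{w}_{j+l}+\frac1h\sum_{l=-q}^{q}\beta_l\,w_{j+1/2+l}.$$ Suppose that $[\mathcal{D}_x]$ is $p$-th order accurate and that $b_0:=\sum_{l=-q}^{q}\beta_l\neq 0$. Let $c\ne 0$ be a real constant (the advection speed of $w_t+cw_x=0$) and suppose that $c\,b_0>0$. Then the semi-discretized FD-FV scheme defined by $[\mathcal{D}_x]$ is at least $(p+1)$-th order accurate. That is, for every fixed real wavenumber $k\neq 0$, with $\theta=kh$ and $A,N$ the amplitude functions of the semi-discretized solution defined in the context, there are functions $c_a(t)$ and $c_n(t)$ independent of $\theta$ such that, for each fixed $t\in[0,T]$, as $h\to0^+$ (equivalently $\theta\to 0$ with $k$ fixed), $$A(t)=e^{-ickt}\left(1+c_a(t)\theta^{p+1}+O(\theta^{p+2})\right),\qquad N(t)=e^{-ickt}\left(1+c_n(t)\theta^{p+1}+O(\theta^{p+2})\right).$$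
   Context: Grid: the real line is divided into uniform cells $\mathcal{C}_j=[x_{j-1/2},x_{j+1/2}]$ of length $h>0$, with $x_{j+1/2}=jh$, $j\in\mathbb{Z}$. The discrete unknowns are cell averages $\overline{w}_j$ (approximating $\frac1h\int_{\mathcal{C}_j}w\,dx$) and nodal values $w_{j+1/2}$ (approximating $w(x_{j+1/2})$). Order of the operator: $[\mathcal{D}_x]$ is $p$-th order accurate ($p\ge1$) if there is a constant $c_p\neq0$, independent of the function $w$ and of $h$, such that for every sufficiently smooth function $w(x)$, when $[\mathcal{D}_xw]_{j+1/2}$ is computed from the exact cell averages $\overline{w}_{j+l}=\frac1h\int_{\mathcal{C}_{j+l}}w\,dx$ and exact nodal values $w_{j+1/2+l}=w(x_{j+1/2+l})$, $$[\mathcal{D}_xw]_{j+1/2}=\partial_xw(x_{j+1/2})+c_p\,\partial_x^{p+1}w(x_{j+1/2})\,h^p+O(h^{p+1}).$$ Semi-discretized FD-FV scheme: applied to the Cauchy problem $w_t+cw_x=0$ on $\mathbb{R}\times[0,T]$, the scheme is the system of ODEs in time $$\frac{d\overline{w}_j}{dt}+\frac ch\left(w_{j+1/2}-w_{j-1/2}\right)=0,\qquad \frac{dw_{j+1/2}}{dt}+c\,[\mathcal{D}_xw]_{j+1/2}=0,\qquad j\in\mathbb{Z}.$$ With initial condition $w(x,0)=e^{ikx}$ ($k$ the wavenumber, $i$ the imaginary unit) and exact initial cell averages and nodal values, its solution has the form $$\overline{w}_j(t)=\frac{1}{i\theta}A(t)e^{ij\theta}(1-e^{-i\theta}),\qquad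 w_{j+1/2}(t)=N(t)e^{ij\theta},\qquad \theta=kh,$$ where $A,N$ (which depend also on $\theta$) are the solution of $$A'(t)+ick\,N(t)=0,\qquad N'(t)+ck\,a(\theta)A(t)+ck\,b(\theta)N(t)=0,\qquad A(0)=N(0)=1,$$ $$a(\theta)=\frac{1-e^{-i\theta}}{i\theta^2}\sum_{l=-q+1}^{q}e^{il\theta}\alpha_l,\qquad b(\theta)=\frac1\theta\sum_{l=-q}^{q}e^{il\theta}\beta_l.$$ The exact solution corresponds to $A(t)=N(t)=e^{-ickt}$. Order of the scheme: the semi-discretized scheme is at least $r$-th order accurate if $A(t)=e^{-ickt}(1+c_a(t)\theta^r+O(\theta^{r+1}))$ and $N(t)=e^{-ickt}(1+c_n(t)\theta^r+O(\theta^{r+1}))$, where $c_a$ and $c_n$ are functions of time independent of $\theta$. *)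

theory Defs
  imports "HOL-Analysis.Analysis" "HOL-Library.Landau_Symbols"
begin

section \<open>Grid functions and the FD-FV operator\<close>

text \<open>
  A cell-averaged grid function is written \<open>wb :: int \<Rightarrow> 'a\<close>, with \<open>wb j\<close> the average on
  the cell \<open>[x\<^bsub>j-1/2\<^esub>, x\<^bsub>j+1/2\<^esub>] = [(j-1)h, jh]\<close>; a nodal grid function is written
  \<open>w :: int \<Rightarrow> 'a\<close>, where the index \<open>j\<close> stands for the node \<open>x\<^bsub>j+1/2\<^esub> = jh\<close>.
\<close>

definition grid_node :: "real \<Rightarrow> int \<Rightarrow> real"
  where "grid_node h j = of_int j * h"

definition exact_average :: "real \<Rightarrow> (real \<Rightarrow> 'a::euclidean_space) \<Rightarrow> int \<Rightarrow> 'a"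
  where "exact_average h w j = (1 / h) *\<^sub>R integral {grid_node h (j - 1)..grid_node h j} w"

definition exact_nodal :: "real \<Rightarrow> (real \<Rightarrow> 'a) \<Rightarrow> int \<Rightarrow> 'a"
  where "exact_nodal h w j = w (grid_node h j)"

definition fdfv_op ::
  "nat \<Rightarrow> (int \<Rightarrow> real) \<Rightarrow> (int \<Rightarrow> real) \<Rightarrow> real \<Rightarrow> (int \<Rightarrow> 'a) \<Rightarrow> (int \<Rightarrow> 'a) \<Rightarrow> int \<Rightarrow> 'a::real_vector"
  where "fdfv_op q \<alpha> \<beta> h wb w j =
    (1 / h) *\<^sub>R (\<Sum>l = - int q + 1..int q. \<alpha> l *\<^sub>R wb (j + l)) +
    (1 / h) *\<^sub>R (\<Sum>l = - int q..int q. \<beta> l *\<^sub>R w (j + l))"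

definition smooth_fun :: "(real \<Rightarrow> real) \<Rightarrow> bool"
  where "smooth_fun w \<longleftrightarrow> (\<forall>n. (deriv ^^ n) w differentiable_on UNIV)"

text \<open>
  Order of accuracy of the operator.  ``Sufficiently smooth'' is read as \<open>C\<^sup>\<infinity>\<close>.  The constant
  hidden in the \<open>O\<close>-term may depend on the function \<open>w\<close> and on the node index \<open>j\<close>; since smooth
  functions may be translated, fixing the index \<open>j\<close> or fixing the point \<open>x\<^bsub>j+1/2\<^esub>\<close> while
  \<open>h \<rightarrow> 0\<close> gives the same notion.
\<close>

definition fdfv_op_order :: "nat \<Rightarrow> (int \<Rightarrow> real) \<Rightarrow> (int \<Rightarrow> real) \<Rightarrow> nat \<Rightarrow> bool"
  where "fdfv_op_order q \<alpha> \<beta> p \<longleftrightarrow>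
    (\<exists>cp::real. cp \<noteq> 0 \<and>
      (\<forall>w. smooth_fun w \<longrightarrow> (\<forall>j.
        (\<lambda>h. fdfv_op q \<alpha> \<beta> h (exact_average h w) (exact_nodal h w) j
              - (deriv w (grid_node h j)
                 + cp * (deriv ^^ (p + 1)) w (grid_node h j) * h ^ p))
          \<in> O[at_right 0](\<lambda>h. h ^ (p + 1)))))"


section \<open>The semi-discretized scheme and its amplitude functions\<close>

definition fdfv_semidiscrete ::
  "nat \<Rightarrow> (int \<Rightarrow> real) \<Rightarrow> (int \<Rightarrow> real) \<Rightarrow> real \<Rightarrow> real \<Rightarrow> real \<Rightarrow>
    (int \<Rightarrow> real \<Rightarrow> complex) \<Rightarrow> (int \<Rightarrow> real \<Rightarrow> complex) \<Rightarrow> bool"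
  where "fdfv_semidiscrete q \<alpha> \<beta> c T h wb w \<longleftrightarrow>
    (\<forall>j. \<forall>t\<in>{0..T}. \<exists>dwb dw.
       (wb j has_vector_derivative dwb) (at t within {0..T}) \<and>
       (w j has_vector_derivative dw) (at t within {0..T}) \<and>
       dwb + (c / h) *\<^sub>R (w j t - w (j - 1) t) = 0 \<and>
       dw + c *\<^sub>R fdfv_op q \<alpha> \<beta> h (\<lambda>i. wb i t) (\<lambda>i. w i t) j = 0)"

definition amp_a :: "nat \<Rightarrow> (int \<Rightarrow> real) \<Rightarrow> real \<Rightarrow> complex"
  where "amp_a q \<alpha> \<theta> =
    (1 - exp (- \<i> * of_real \<theta>)) / (\<i> * of_real \<theta> ^ 2) *
    (\<Sum>l = - int q + 1..int q. exp (\<i> * of_int l * of_real \<theta>) * of_real (\<alpha> l))"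

definition amp_b :: "nat \<Rightarrow> (int \<Rightarrow> real) \<Rightarrow> real \<Rightarrow> complex"
  where "amp_b q \<beta> \<theta> =
    1 / of_real \<theta> *
    (\<Sum>l = - int q..int q. exp (\<i> * of_int l * of_real \<theta>) * of_real (\<beta> l))"

definition amplitudes ::
  "nat \<Rightarrow> (int \<Rightarrow> real) \<Rightarrow> (int \<Rightarrow> real) \<Rightarrow> real \<Rightarrow> real \<Rightarrow> real \<Rightarrow> real \<Rightarrow>
    (real \<Rightarrow> complex) \<Rightarrow> (real \<Rightarrow> complex) \<Rightarrow> bool"
  where "amplitudes q \<alpha> \<beta> c T k h A N \<longleftrightarrow>
    A 0 = 1 \<and> N 0 = 1 \<and>
    (\<forall>t\<in>{0..T}. \<exists>dA dN.
       (A has_vector_derivative dA) (at t within {0..T}) \<and>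
       (N has_vector_derivative dN) (at t within {0..T}) \<and>
       dA + \<i> * of_real c * of_real k * N t = 0 \<and>
       dN + of_real c * of_real k * amp_a q \<alpha> (k * h) * A t
          + of_real c * of_real k * amp_b q \<beta> (k * h) * N t = 0)"

text \<open>
  Order of accuracy of the scheme.  The wavenumber \<open>k\<close> is fixed, so \<open>\<theta> = k h\<close> tends to zero
  with \<open>h\<close>; \<open>A h\<close> and \<open>N h\<close> are the amplitude functions for the grid size \<open>h\<close>.  The amplitude
  functions exist for every \<open>h > 0\<close> (lemma \<open>amplitudes_exist\<close> below), so the quantification over
  them is not vacuous.
\<close>

definition fdfv_scheme_order_at_least ::
  "nat \<Rightarrow> (int \<Rightarrow> real) \<Rightarrow> (int \<Rightarrow> real) \<Rightarrow> real \<Rightarrow> real \<Rightarrow> nat \<Rightarrow> bool"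
  where "fdfv_scheme_order_at_least q \<alpha> \<beta> c T r \<longleftrightarrow>
    (\<forall>k::real. k \<noteq> 0 \<longrightarrow>
      (\<exists>ca cn :: real \<Rightarrow> complex.
        \<forall>A N :: real \<Rightarrow> real \<Rightarrow> complex.
          (\<forall>h>0. amplitudes q \<alpha> \<beta> c T k h (A h) (N h)) \<longrightarrow>
          (\<forall>t\<in>{0..T}.
            (\<exists>R \<in> O[at_right 0](\<lambda>h. of_real (k * h) ^ (r + 1)). \<forall>h>0.
               A h t = exp (- \<i> * of_real c * of_real k * of_real t)
                        * (1 + ca t * of_real (k * h) ^ r + R h)) \<and>
            (\<exists>R \<in> O[at_right 0](\<lambda>h. of_real (k * h) ^ (r + 1)). \<forall>h>0.
               N h t = exp (- \<i> * of_real c * of_real k * of_real t)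
                        * (1 + cn t * of_real (k * h) ^ r + R h)))))"


section \<open>Consistency of the definitions\<close>

text \<open>
  The amplitude system is exactly the scheme for the initial condition \<open>exp (\<i> k x)\<close> under the
  wave ansatz; \<open>\<theta> \<notin> 2\<pi>\<int>\<close> is only needed because the cell averages do not
  determine \<open>A\<close> otherwise.
\<close>

definition wave_average :: "real \<Rightarrow> (real \<Rightarrow> complex) \<Rightarrow> int \<Rightarrow> real \<Rightarrow> complex"
  where "wave_average \<theta> A j t =
    1 / (\<i> * of_real \<theta>) * A t * exp (\<i> * of_int j * of_real \<theta>) * (1 - exp (- \<i> * of_real \<theta>))"

definition wave_nodal :: "real \<Rightarrow> (real \<Rightarrow> complex) \<Rightarrow> int \<Rightarrow> real \<Rightarrow> complex"
  where "wave_nodal \<theta> N j t = N t * exp (\<i> * of_int j * of_real \<theta>)"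

lemma exact_average_wave:
  fixes k h :: real
  assumes "k \<noteq> 0" "h > 0"
  shows "exact_average h (\<lambda>x. exp (\<i> * of_real k * of_real x)) j =
    1 / (\<i> * of_real (k * h)) * exp (\<i> * of_int j * of_real (k * h)) * (1 - exp (- \<i> * of_real (k * h)))"
proof -
  let ?F = "\<lambda>x::real. exp (\<i> * of_real k * of_real x) / (\<i> * of_real k)"
  have "((\<lambda>x. exp (\<i> * of_real k * of_real x)) has_integral
      (?F (grid_node h j) - ?F (grid_node h (j - 1)))) {grid_node h (j - 1)..grid_node h j}"
  proof (rule fundamental_theorem_of_calculus)
    show "grid_node h (j - 1) \<le> grid_node h j"
      using assms by (simp add: grid_node_def algebra_simps)
    fix x :: real
    have "((\<lambda>z. exp (\<i> * of_real k * z) / (\<i> * of_real k)) has_field_derivative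
        exp (\<i> * of_real k * of_real x)) (at (of_real x))"
      using assms by (auto intro!: derivative_eq_intros)
    from has_vector_derivative_real_field[OF this]
    show "(?F has_vector_derivative exp (\<i> * of_real k * of_real x))
        (at x within {grid_node h (j - 1)..grid_node h j})" .
  qed
  hence "integral {grid_node h (j - 1)..grid_node h j} (\<lambda>x. exp (\<i> * of_real k * of_real x))
      = ?F (grid_node h j) - ?F (grid_node h (j - 1))"
    by (rule integral_unique)
  moreover have "exp (\<i> * of_real k * of_real (grid_node h (j - 1))) =
      exp (\<i> * of_int j * of_real (k * h)) * exp (- \<i> * of_real (k * h))"
    unfolding exp_add[symmetric] by (simp add: grid_node_def algebra_simps)
  moreover have "exp (\<i> * of_real k * of_real (grid_node h j)) = exp (\<i> * of_int j * of_real (k * h))"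
    by (simp add: grid_node_def algebra_simps)
  ultimately show ?thesis
    using assms by (simp add: exact_average_def scaleR_conv_of_real field_simps)
qed

lemma fdfv_op_wave:
  fixes k h :: real
  assumes "k \<noteq> 0" "h > 0"
  shows "c *\<^sub>R fdfv_op q \<alpha> \<beta> h (\<lambda>i. wave_average (k * h) A i t) (\<lambda>i. wave_nodal (k * h) N i t) j =
    (of_real c * of_real k * amp_a q \<alpha> (k * h) * A t
     + of_real c * of_real k * amp_b q \<beta> (k * h) * N t) * exp (\<i> * of_int j * of_real (k * h))"
proof -
  have e: "exp (\<i> * of_int (j + l) * of_real (k * h)) =
      exp (\<i> * of_int l * of_real (k * h)) * exp (\<i> * of_int j * of_real (k * h) :: complex)" for l
    unfolding exp_add[symmetric] by (simp add: algebra_simps)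
  have 1: "(\<Sum>l = - int q + 1..int q. \<alpha> l *\<^sub>R wave_average (k * h) A (j + l) t) =
      1 / (\<i> * of_real (k * h)) * A t * exp (\<i> * of_int j * of_real (k * h)) * (1 - exp (- \<i> * of_real (k * h)))
      * (\<Sum>l = - int q + 1..int q. exp (\<i> * of_int l * of_real (k * h)) * of_real (\<alpha> l))"
    unfolding sum_distrib_left wave_average_def e
    by (intro sum.cong refl) (simp add: scaleR_conv_of_real mult_ac)
  have 2: "(\<Sum>l = - int q..int q. \<beta> l *\<^sub>R wave_nodal (k * h) N (j + l) t) =
      N t * exp (\<i> * of_int j * of_real (k * h))
      * (\<Sum>l = - int q..int q. exp (\<i> * of_int l * of_real (k * h)) * of_real (\<beta> l))"
    unfolding sum_distrib_left wave_nodal_def e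
    by (intro sum.cong refl) (simp add: scaleR_conv_of_real mult_ac)
  show ?thesis
    unfolding fdfv_op_def 1 2 amp_a_def amp_b_def
    using assms by (simp add: scaleR_conv_of_real field_simps power2_eq_square)
qed

lemma has_vector_derivative_cmult_iff:
  fixes f :: "real \<Rightarrow> complex" and z :: complex
  assumes "z \<noteq> 0"
  shows "((\<lambda>t. z * f t) has_vector_derivative z * d) F \<longleftrightarrow> (f has_vector_derivative d) F"
proof
  assume "((\<lambda>t. z * f t) has_vector_derivative z * d) F"
  from bounded_linear.has_vector_derivative[OF bounded_linear_mult_right this, of "1 / z"]
  show "(f has_vector_derivative d) F"
    using assms by simp
next
  assume "(f has_vector_derivative d) F"
  thus "((\<lambda>t. z * f t) has_vector_derivative z * d) F"
    by (rule bounded_linear.has_vector_derivative[OF bounded_linear_mult_right])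
qed

lemma wave_scheme_iff_amplitudes:
  fixes k h c T :: real
  assumes k: "k \<noteq> 0" and h: "h > 0" and \<theta>: "exp (- \<i> * of_real (k * h)) \<noteq> 1"
  defines "w0 \<equiv> \<lambda>x::real. exp (\<i> * of_real k * of_real x)"
  shows "(fdfv_semidiscrete q \<alpha> \<beta> c T h (wave_average (k * h) A) (wave_nodal (k * h) N) \<and>
      (\<forall>j. wave_average (k * h) A j 0 = exact_average h w0 j \<and>
           wave_nodal (k * h) N j 0 = exact_nodal h w0 j))
    \<longleftrightarrow> amplitudes q \<alpha> \<beta> c T k h A N"
proof -
  define E where "E j = exp (\<i> * of_int j * of_real (k * h) :: complex)" for j :: int
  define G where "G j = 1 / (\<i> * of_real (k * h)) * E j * (1 - exp (- \<i> * of_real (k * h)))" for j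
  have E: "E j \<noteq> 0" for j by (simp add: E_def)
  have G: "G j \<noteq> 0" for j using k h \<theta> E by (simp add: G_def)
  have wa: "wave_average (k * h) A j = (\<lambda>t. G j * A t)" for j
    by (simp add: wave_average_def G_def E_def fun_eq_iff mult_ac)
  have wn: "wave_nodal (k * h) N j = (\<lambda>t. E j * N t)" for j
    by (simp add: wave_nodal_def E_def fun_eq_iff mult_ac)
  have "E (j - 1) = E j * exp (- \<i> * of_real (k * h))" for j
    unfolding E_def exp_add[symmetric] by (simp add: algebra_simps)
  hence flux: "(c / h) *\<^sub>R (E j * N t - E (j - 1) * N t) = G j * (\<i> * of_real c * of_real k * N t)" for j t
    using k h by (simp add: G_def scaleR_conv_of_real field_simps)
  have init: "(\<forall>j. wave_average (k * h) A j 0 = exact_average h w0 j \<and>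
           wave_nodal (k * h) N j 0 = exact_nodal h w0 j) \<longleftrightarrow> A 0 = 1 \<and> N 0 = 1"
  proof -
    have "exact_average h w0 j = G j" for j
      unfolding w0_def exact_average_wave[OF k h] by (simp add: G_def E_def)
    moreover have "exact_nodal h w0 j = E j" for j
      by (simp add: exact_nodal_def w0_def E_def grid_node_def algebra_simps)
    ultimately show ?thesis using E G by (auto simp: wa wn)
  qed
  define a where "a = of_real c * of_real k * amp_a q \<alpha> (k * h)"
  define b where "b = of_real c * of_real k * amp_b q \<beta> (k * h)"
  define u where "u = \<i> * of_real c * of_real k"
  have op: "c *\<^sub>R fdfv_op q \<alpha> \<beta> h (\<lambda>i. G i * A t) (\<lambda>i. E i * N t) j = E j * (a * A t + b * N t)" for j t
    using fdfv_op_wave[OF k h, of c q \<alpha> \<beta> A t N j, unfolded wa wn, folded a_def b_def E_def]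
    by (simp add: mult.commute)
  have step: "(\<exists>dwb dw.
       (wave_average (k * h) A j has_vector_derivative dwb) (at t within {0..T}) \<and>
       (wave_nodal (k * h) N j has_vector_derivative dw) (at t within {0..T}) \<and>
       dwb + (c / h) *\<^sub>R (wave_nodal (k * h) N j t - wave_nodal (k * h) N (j - 1) t) = 0 \<and>
       dw + c *\<^sub>R fdfv_op q \<alpha> \<beta> h (\<lambda>i. wave_average (k * h) A i t) (\<lambda>i. wave_nodal (k * h) N i t) j = 0)
    \<longleftrightarrow> (\<exists>dA dN.
       (A has_vector_derivative dA) (at t within {0..T}) \<and>
       (N has_vector_derivative dN) (at t within {0..T}) \<and>
       dA + u * N t = 0 \<and> dN + a * A t + b * N t = 0)" (is "?L \<longleftrightarrow> ?R") for j t
  proof -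
    have "?L \<longleftrightarrow> ((\<lambda>t. G j * A t) has_vector_derivative G j * - (u * N t)) (at t within {0..T}) \<and>
        ((\<lambda>t. E j * N t) has_vector_derivative E j * - (a * A t + b * N t)) (at t within {0..T})"
      unfolding wa wn flux op u_def[symmetric] eq_neg_iff_add_eq_0[symmetric] mult_minus_right by simp
    also have "\<dots> \<longleftrightarrow> (A has_vector_derivative - (u * N t)) (at t within {0..T}) \<and>
        (N has_vector_derivative - (a * A t + b * N t)) (at t within {0..T})"
      using G E by (simp only: has_vector_derivative_cmult_iff not_False_eq_True)
    also have "\<dots> \<longleftrightarrow> ?R"
      unfolding add.assoc eq_neg_iff_add_eq_0[symmetric] by auto
    finally show ?thesis .
  qed
  show ?thesis
    unfolding fdfv_semidiscrete_def amplitudes_def init step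
    by (auto simp: a_def b_def u_def)
qed

lemma linear_system_solution_exists:
  fixes u v s :: complex
  assumes "u \<noteq> 0"
  shows "\<exists>A N :: real \<Rightarrow> complex. A 0 = 1 \<and> N 0 = 1 \<and>
    (\<forall>t. (A has_vector_derivative - (u * N t)) (at t) \<and>
         (N has_vector_derivative - (v * A t + s * N t)) (at t))"
proof -
  have field: "\<exists>A N :: real \<Rightarrow> complex. A 0 = 1 \<and> N 0 = 1 \<and>
    (\<forall>t. (A has_vector_derivative - (u * N t)) (at t) \<and>
         (N has_vector_derivative - (v * A t + s * N t)) (at t))"
    if "F 0 = 1" "F' 0 = - u"
      "\<And>z. (F has_field_derivative F' z) (at z)"
      "\<And>z. (F' has_field_derivative (u * v * F z - s * F' z)) (at z)" for F F' :: "complex \<Rightarrow> complex"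
  proof (intro exI conjI allI)
    let ?A = "\<lambda>t::real. F (of_real t)" and ?N = "\<lambda>t::real. - F' (of_real t) / u"
    show "?A 0 = 1" "?N 0 = 1" using that(1,2) assms by simp_all
    fix t :: real
    show "(?A has_vector_derivative - (u * ?N t)) (at t)"
      using has_vector_derivative_real_field[OF that(3)] assms by simp
    have "((\<lambda>z. - F' z / u) has_field_derivative - (u * v * F (of_real t) - s * F' (of_real t)) / u) (at (of_real t))"
      by (intro DERIV_cdivide DERIV_minus that(4))
    note has_vector_derivative_real_field[OF this]
    also have "- (u * v * F (of_real t) - s * F' (of_real t)) / u = - (v * ?A t + s * ?N t)"
      using assms by (simp add: field_simps)
    finally show "(?N has_vector_derivative - (v * ?A t + s * ?N t)) (at t)" .
  qed
  define d where "d = csqrt (s\<^sup>2 + 4 * u * v)"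
  have d: "d * d = s * s + 4 * (u * v)"
    using power2_csqrt[of "s\<^sup>2 + 4 * u * v"] by (simp add: d_def power2_eq_square)
  show ?thesis
  proof (cases "d = 0")
    case True
    define m g where "m = - s / 2" and "g = - u - m"
    have s: "s = - 2 * m" by (simp add: m_def)
    have "4 * (u * v + m * m) = 0"
      using d True by (simp add: s algebra_simps)
    hence "u * v + m * m = 0" by (simp only: mult_eq_0_iff) simp
    hence mm: "u * v = - (m * m)" by (simp add: eq_neg_iff_add_eq_0)
    show ?thesis
    proof (rule field[of "\<lambda>z. (1 + g * z) * exp (m * z)" "\<lambda>z. (g + m * (1 + g * z)) * exp (m * z)"])
      show "((\<lambda>z. (1 + g * z) * exp (m * z)) has_field_derivative (g + m * (1 + g * z)) * exp (m * z)) (at z)" for z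
        by (auto intro!: derivative_eq_intros simp: algebra_simps)
      show "((\<lambda>z. (g + m * (1 + g * z)) * exp (m * z)) has_field_derivative
         u * v * ((1 + g * z) * exp (m * z)) - s * ((g + m * (1 + g * z)) * exp (m * z))) (at z)" for z
        unfolding mm s by (auto intro!: derivative_eq_intros simp: algebra_simps)
    qed (simp_all add: g_def)
  next
    case False
    define m n where "m = (- s + d) / 2" and "n = (- s - d) / 2"
    have s: "s = - m - n" by (simp add: m_def n_def field_simps)
    have "4 * (m * n) = s * s - d * d" by (simp add: m_def n_def field_simps)
    hence uv: "u * v = - (m * n)" using d by simp
    have mn: "m - n \<noteq> 0" using False by (simp add: m_def n_def field_simps)
    define P Q where "P = (- u - n) / (m - n)" and "Q = (m + u) / (m - n)"
    show ?thesis
    proof (rule field[of "\<lambda>z. P * exp (m * z) + Q * exp (n * z)"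
          "\<lambda>z. P * m * exp (m * z) + Q * n * exp (n * z)"])
      show "P * exp (m * 0) + Q * exp (n * 0) = 1"
        using mn by (simp add: P_def Q_def flip: add_divide_distrib)
      have "P * m + Q * n = ((- u - n) * m + (m + u) * n) / (m - n)"
        by (simp add: P_def Q_def flip: add_divide_distrib)
      also have "(- u - n) * m + (m + u) * n = - u * (m - n)" by (simp add: algebra_simps)
      finally show "P * m * exp (m * 0) + Q * n * exp (n * 0) = - u" using mn by simp
      show "((\<lambda>z. P * exp (m * z) + Q * exp (n * z)) has_field_derivative
          P * m * exp (m * z) + Q * n * exp (n * z)) (at z)" for z
        by (auto intro!: derivative_eq_intros simp: algebra_simps)
      show "((\<lambda>z. P * m * exp (m * z) + Q * n * exp (n * z)) has_field_derivative
          u * v * (P * exp (m * z) + Q * exp (n * z)) - s * (P * m * exp (m * z) + Q * n * exp (n * z))) (at z)" for z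
        unfolding uv s by (auto intro!: derivative_eq_intros simp: algebra_simps)
    qed
  qed
qed

lemma amplitudes_exist:
  assumes "c \<noteq> 0" "k \<noteq> 0"
  shows "\<exists>A N. amplitudes q \<alpha> \<beta> c T k h A N"
proof -
  obtain A N where AN: "A 0 = 1" "N 0 = 1"
    "\<And>t. (A has_vector_derivative - (\<i> * of_real c * of_real k * N t)) (at t)"
    "\<And>t. (N has_vector_derivative - (of_real c * of_real k * amp_a q \<alpha> (k * h) * A t
            + of_real c * of_real k * amp_b q \<beta> (k * h) * N t)) (at t)"
    using linear_system_solution_exists[of "\<i> * of_real c * of_real k"
        "of_real c * of_real k * amp_a q \<alpha> (k * h)" "of_real c * of_real k * amp_b q \<beta> (k * h)"] assms
    by auto
  have "amplitudes q \<alpha> \<beta> c T k h A N"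
    unfolding amplitudes_def
    using AN(1,2) AN(3,4)[THEN has_vector_derivative_at_within]
    by (intro conjI ballI exI) (assumption | simp)+
  thus ?thesis by blast
qed

end

theory Submission
  imports Defs
begin

text \<open>
  Put \<open>P = c k\<close>.  Shifting the eigenvalues of the amplitude system by \<open>\<i> P\<close> turns its characteristic
  equation into \<open>\<mu>\<^sup>2 + F\<^sub>1 \<mu> + F\<^sub>0 = 0\<close>.  The operator applied to plane waves gives
  \<open>a + b = \<i> + C h\<^sup>p + O(h\<^bsup>p+1\<^esup>)\<close>, hence \<open>F\<^sub>0 = O(h\<^sup>p)\<close>, while \<open>F\<^sub>1\<close> behaves like \<open>c b\<^sub>0 / h\<close>.  Dividing by the
  large \<open>F\<^sub>1\<close> gains one order: the small root is \<open>\<mu> = d h\<^bsup>p+1\<^esup> + O(h\<^bsup>p+2\<^esup>)\<close>.  The other root \<open>\<nu>\<close> behaves like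
  \<open>- c b\<^sub>0 / h\<close>, so because \<open>c b\<^sub>0 > 0\<close> the parasitic mode \<open>exp (\<nu> t)\<close> is exponentially small for
  \<open>t > 0\<close>; moreover its weight in \<open>A\<close> is only \<open>O(h\<^bsup>p+2\<^esup>)\<close>.
\<close>

section \<open>Decoupling the amplitude system along its eigenmodes\<close>

text \<open>The integrating factor \<open>exp (- l * t)\<close> turns \<open>y\<close> into a
  constant. Derivatives are taken within \<open>{0..T}\<close>, as in
  \<open>amplitudes\<close>.\<close>

lemma linear_ode_unique:
  fixes y :: "real \<Rightarrow> complex"
  assumes y: "\<And>t. t \<in> {0..T} \<Longrightarrow> (y has_vector_derivative l * y t) (at t within {0..T})"
    and t: "t \<in> {0..T}"
  shows "y t = y 0 * exp (l * of_real t)"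
proof -
  let ?g = "\<lambda>t. y t * exp (- l * of_real t)"
  have g: "(?g has_vector_derivative 0) (at s within {0..T})" if s: "s \<in> {0..T}" for s
  proof -
    have "((\<lambda>z. exp (- l * z)) has_field_derivative - l * exp (- l * of_real s)) (at (of_real s))"
      by (auto intro!: derivative_eq_intros)
    hence e: "((\<lambda>t. exp (- l * of_real t)) has_vector_derivative - l * exp (- l * of_real s))
        (at s within {0..T})"
      by (rule has_vector_derivative_at_within[OF has_vector_derivative_real_field])
    from has_vector_derivative_mult[OF y[OF s] e] show ?thesis
      by (simp add: algebra_simps)
  qed
  obtain C where C: "\<And>s. s \<in> {0..T} \<Longrightarrow> ?g s = C"
    using has_vector_derivative_zero_constant[OF convex_real_interval(5) g] by blast
  have "?g t = ?g 0" using C[OF t] C[of 0] t by auto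
  hence "y t * (exp (- l * of_real t) * exp (l * of_real t)) = y 0 * exp (l * of_real t)"
    by (simp add: mult.assoc[symmetric])
  thus ?thesis by (simp add: exp_add[symmetric])
qed

text \<open>
  The left eigenvector for the eigenvalue \<open>\<nu> - \<i> P\<close> decouples the system.
\<close>
lemma amplitudes_mode:
  fixes c k :: real
  defines "P \<equiv> complex_of_real (c * k)"
  assumes amp: "amplitudes q \<alpha> \<beta> c T k h A N"
    and sum: "\<mu> + \<nu> = 2 * \<i> * P - P * amp_b q \<beta> (k * h)"
    and prod: "\<mu> * \<nu> = - P\<^sup>2 * (1 + \<i> * (amp_a q \<alpha> (k * h) + amp_b q \<beta> (k * h)))"
    and t: "t \<in> {0..T}"
  shows "((\<i> * P - \<mu>) * A t - \<i> * P * N t) * exp (\<i> * P * of_real t) = - \<mu> * exp (\<nu> * of_real t)"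
proof -
  define a b where "a = amp_a q \<alpha> (k * h)" and "b = amp_b q \<beta> (k * h)"
  let ?y = "\<lambda>t. (\<i> * P - \<mu>) * A t - \<i> * P * N t"
  have "(?y has_vector_derivative (\<nu> - \<i> * P) * ?y s) (at s within {0..T})" if s: "s \<in> {0..T}" for s
  proof -
    obtain dA dN where d: "(A has_vector_derivative dA) (at s within {0..T})"
       "(N has_vector_derivative dN) (at s within {0..T})"
       "dA + \<i> * P * N s = 0" "dN + P * a * A s + P * b * N s = 0"
      using amp s unfolding amplitudes_def P_def a_def b_def of_real_mult mult.assoc by blast
    have dA: "dA = - \<i> * P * N s" using d(3) by (simp add: eq_neg_iff_add_eq_0)
    have dN: "dN = - P * a * A s - P * b * N s"
      using d(4) by (simp add: algebra_simps eq_neg_iff_add_eq_0)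
    have \<mu>: "P * b = 2 * \<i> * P - \<mu> - \<nu>" using sum by (simp add: b_def algebra_simps)
    \<comment> \<open>The product of the two eigenvalues \<open>\<mu> - \<i> * P\<close> and
      \<open>\<nu> - \<i> * P\<close> is the determinant of the system matrix, here obtained from
      \<open>sum\<close> and \<open>prod\<close>.\<close>
    have "- (\<i> * P) * (P * a) = P\<^sup>2 + \<mu> * \<nu> + \<i> * P * (P * b)"
      unfolding prod by (simp add: a_def b_def algebra_simps power2_eq_square)
    also have "\<dots> = P\<^sup>2 + \<mu> * \<nu> + \<i> * P * (2 * \<i> * P - \<mu> - \<nu>)" by (simp only: \<mu>)
    also have "\<dots> = (\<nu> - \<i> * P) * (\<mu> - \<i> * P)"
      by (simp add: algebra_simps power2_eq_square)
    finally have a: "- (\<i> * P) * (P * a) = (\<nu> - \<i> * P) * (\<mu> - \<i> * P)" .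
    have "(?y has_vector_derivative (\<i> * P - \<mu>) * dA - \<i> * P * dN) (at s within {0..T})"
      by (intro has_vector_derivative_diff
           bounded_linear.has_vector_derivative[OF bounded_linear_mult_right] d(1,2))
    also have "(\<i> * P - \<mu>) * dA - \<i> * P * dN
        = - (\<i> * P - \<mu>) * (\<i> * P) * N s - (- (\<i> * P) * (P * a)) * A s + \<i> * P * (P * b) * N s"
      unfolding dA dN by (simp add: algebra_simps)
    also have "\<dots> = (\<nu> - \<i> * P) * ?y s"
      unfolding a \<mu> by (simp add: algebra_simps)
    finally show ?thesis .
  qed
  \<comment> \<open>Since \<open>A 0 = N 0 = 1\<close>, the initial value of \<open>?y\<close> is
    \<open>(\<i> * P - \<mu>) - \<i> * P = - \<mu>\<close>.\<close>
  from linear_ode_unique[OF this t]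
  have "?y t = - \<mu> * exp ((\<nu> - \<i> * P) * of_real t)"
    using amp by (simp add: amplitudes_def)
  hence "?y t * exp (\<i> * P * of_real t) = - \<mu> * (exp ((\<nu> - \<i> * P) * of_real t) * exp (\<i> * P * of_real t))"
    by simp
  thus ?thesis by (simp add: exp_add[symmetric] algebra_simps)
qed

section \<open>The order condition tested on plane waves\<close>

text \<open>\<open>fdfv_op_order\<close> speaks of real functions only, so the complex wave enters
  through \<open>L = Re\<close> and \<open>L = Im\<close>; differentiation passes through
  \<open>L\<close> and multiplies the wave by \<open>\<i> * k\<close>.\<close>

lemma deriv_funpow_wave:
  assumes L: "bounded_linear (L :: complex \<Rightarrow> real)"
  shows "(deriv ^^ n) (\<lambda>x. L (exp (\<i> * of_real k * of_real x))) =
    (\<lambda>x. L ((\<i> * of_real k) ^ n * exp (\<i> * of_real k * of_real x)))"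
    and "(\<lambda>x. L ((\<i> * of_real k) ^ n * exp (\<i> * of_real k * of_real x))) differentiable_on UNIV"
proof -
  let ?f = "\<lambda>n x. L ((\<i> * of_real k) ^ n * exp (\<i> * of_real k * of_real x))"
  have D: "(?f n has_field_derivative ?f (Suc n) x) (at x)" for n x
  proof -
    have "((\<lambda>z. (\<i> * of_real k) ^ n * exp (\<i> * of_real k * z)) has_field_derivative
        (\<i> * of_real k) ^ Suc n * exp (\<i> * of_real k * of_real x)) (at (of_real x))"
      by (auto intro!: derivative_eq_intros)
    from bounded_linear.has_vector_derivative[OF L has_vector_derivative_real_field[OF this]]
    show ?thesis by (simp add: has_real_derivative_iff_has_vector_derivative)
  qed
  show "?f n differentiable_on UNIV"
    unfolding differentiable_on_def
    using D[of n] real_differentiable_def by (auto intro: differentiable_at_withinI)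
  show "(deriv ^^ n) (\<lambda>x. L (exp (\<i> * of_real k * of_real x))) = ?f n"
  proof (induction n)
    case (Suc n)
    show ?case unfolding funpow.simps o_apply Suc using DERIV_imp_deriv[OF D] by blast
  qed simp
qed

text \<open>The coefficients of the operator are real, so it commutes with real-linear maps;
  continuity of \<open>w\<close> lets \<open>L\<close> pass through the cell integrals.\<close>

lemma bounded_linear_fdfv_op_exact:
  fixes w :: "real \<Rightarrow> complex"
  assumes L: "bounded_linear (L :: complex \<Rightarrow> real)" and w: "continuous_on UNIV w"
  shows "fdfv_op q \<alpha> \<beta> h (exact_average h (\<lambda>x. L (w x))) (exact_nodal h (\<lambda>x. L (w x))) j =
    L (fdfv_op q \<alpha> \<beta> h (exact_average h w) (exact_nodal h w) j)"
proof -
  interpret L: bounded_linear L by (rule L)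
  have "exact_average h (\<lambda>x. L (w x)) i = L (exact_average h w i)" for i
  proof -
    have "w integrable_on {grid_node h (i - 1)..grid_node h i}"
      by (rule integrable_continuous_real) (rule continuous_on_subset[OF w subset_UNIV])
    from integral_linear[OF this L] show ?thesis
      by (simp add: exact_average_def L.scaleR o_def)
  qed
  thus ?thesis
    by (simp add: fdfv_op_def exact_nodal_def L.add L.scaleR L.sum)
qed

lemma bigo_of_Re_Im:
  fixes f :: "'a \<Rightarrow> complex" and g :: "'a \<Rightarrow> real"
  assumes "(\<lambda>x. Re (f x)) \<in> O[F](g)" "(\<lambda>x. Im (f x)) \<in> O[F](g)"
  shows "f \<in> O[F](\<lambda>x. of_real (g x))"
proof -
  have "(\<lambda>x. complex_of_real (Re (f x)) + \<i> * complex_of_real (Im (f x))) \<in> O[F](\<lambda>x. of_real (g x))"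
    using assms by (intro sum_in_bigo) (simp_all add: landau_o.big.of_real_iff)
  thus ?thesis by (simp add: complex_eq[symmetric])
qed

text \<open>A plane wave is an eigenfunction of the operator with eigenvalue
  \<open>k * (a + b)\<close>, so accuracy of the operator becomes an expansion of
  \<open>a + b\<close> in powers of \<open>h\<close>.\<close>

lemma fdfv_op_order_symbol:
  assumes "fdfv_op_order q \<alpha> \<beta> p" "k \<noteq> 0"
  obtains C :: complex where
    "(\<lambda>h. amp_a q \<alpha> (k * h) + amp_b q \<beta> (k * h) - (\<i> + C * of_real h ^ p))
       \<in> O[at_right 0](\<lambda>h. of_real h ^ (p + 1))"
proof -
  obtain cp where cp: "\<And>w j. smooth_fun w \<Longrightarrow>
        (\<lambda>h. fdfv_op q \<alpha> \<beta> h (exact_average h w) (exact_nodal h w) j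
              - (deriv w (grid_node h j)
                 + cp * (deriv ^^ (p + 1)) w (grid_node h j) * h ^ p))
          \<in> O[at_right 0](\<lambda>h. h ^ (p + 1))"
    using assms unfolding fdfv_op_order_def by blast
  \<comment> \<open>The error term \<open>cp * (\<i> * k) ^ (p + 1) * h ^ p\<close> divided by
    \<open>k\<close>, so that \<open>e\<close> is the operator error at the node 0, where the wave
    equals 1.\<close>
  define C where "C = of_real cp * (\<i> * of_real k) ^ (p + 1) / of_real k"
  define s where "s h = amp_a q \<alpha> (k * h) + amp_b q \<beta> (k * h)" for h
  define e where "e h = of_real k * (s h - (\<i> + C * of_real h ^ p))" for h
  have *: "(\<lambda>h. L (e h)) \<in> O[at_right 0](\<lambda>h. h ^ (p + 1))"
    if L: "bounded_linear (L :: complex \<Rightarrow> real)" for L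
  proof -
    interpret L: bounded_linear L by (rule L)
    let ?w = "\<lambda>x. exp (\<i> * of_real k * of_real x) :: complex"
    note D = deriv_funpow_wave[OF L, where k = k]
    have "smooth_fun (\<lambda>x. L (?w x))"
      unfolding smooth_fun_def D(1) using D(2) by blast
    from cp[OF this, of 0]
    have "(\<lambda>h. L (fdfv_op q \<alpha> \<beta> h (exact_average h ?w) (exact_nodal h ?w) 0)
              - (L (\<i> * of_real k) + cp * L ((\<i> * of_real k) ^ (p + 1)) * h ^ p))
          \<in> O[at_right 0](\<lambda>h. h ^ (p + 1))"
      unfolding D(1) D(1)[of 1, unfolded One_nat_def funpow.simps o_id]
      by (subst (asm) bounded_linear_fdfv_op_exact[OF L]) (auto simp: grid_node_def intro!: continuous_intros)
    moreover have "eventually (\<lambda>h. L (fdfv_op q \<alpha> \<beta> h (exact_average h ?w) (exact_nodal h ?w) 0)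
              - (L (\<i> * of_real k) + cp * L ((\<i> * of_real k) ^ (p + 1)) * h ^ p) = L (e h)) (at_right 0)"
      using eventually_at_right_less[of 0]
    proof eventually_elim
      case (elim h)
      \<comment> \<open>Exact grid data of the wave are the ansatz with both amplitudes constantly
        1, so \<open>fdfv_op_wave\<close> evaluates the operator on them; the time argument 0 is
        arbitrary.\<close>
      have "exact_average h ?w = (\<lambda>i. wave_average (k * h) (\<lambda>_. 1) i 0)"
        using exact_average_wave[OF assms(2) elim] by (auto simp: wave_average_def)
      moreover have "exact_nodal h ?w = (\<lambda>i. wave_nodal (k * h) (\<lambda>_. 1) i 0)"
        by (auto simp: wave_nodal_def exact_nodal_def grid_node_def algebra_simps)
      ultimately have "fdfv_op q \<alpha> \<beta> h (exact_average h ?w) (exact_nodal h ?w) 0 = of_real k * s h"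
        using fdfv_op_wave[OF assms(2) elim, of 1 q \<alpha> \<beta> "\<lambda>_. 1" 0 "\<lambda>_. 1" 0]
        by (simp add: s_def algebra_simps)
      moreover have "e h = of_real k * s h - (\<i> * of_real k + (cp * h ^ p) *\<^sub>R (\<i> * of_real k) ^ (p + 1))"
        using assms(2) by (simp add: e_def C_def scaleR_conv_of_real field_simps)
      ultimately show ?case
        by (simp add: L.diff L.add L.scaleR del: power_Suc)
    qed
    ultimately show ?thesis by (subst (asm) landau_o.big.in_cong)
  qed
  have "e \<in> O[at_right 0](\<lambda>h. of_real (h ^ (p + 1)))"
    by (intro bigo_of_Re_Im * bounded_linear_Re bounded_linear_Im)
  hence "(\<lambda>h. s h - (\<i> + C * of_real h ^ p)) \<in> O[at_right 0](\<lambda>h. of_real h ^ (p + 1))"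
    using assms(2) by (simp only: e_def[abs_def] of_real_power cmult_in_bigo_iff of_real_eq_0_iff) blast
  thus ?thesis using that unfolding s_def by blast
qed

section \<open>Asymptotics of exponentials and of the symbol \<open>b\<close>\<close>

text \<open>Taylor remainders of order one and two; their factor \<open>exp \<bar>Re z\<bar>\<close>
  is eventually at most \<open>exp 1\<close>.\<close>

lemma exp_minus_one_bigo:
  fixes f :: "'a \<Rightarrow> complex"
  assumes "(f \<longlongrightarrow> 0) F"
  shows "(\<lambda>x. exp (f x) - 1) \<in> O[F](f)" and "(\<lambda>x. exp (f x) - 1 - f x) \<in> O[F](\<lambda>x. f x ^ 2)"
proof -
  have ev: "eventually (\<lambda>x. exp \<bar>Re (f x)\<bar> \<le> exp 1) F"
    using tendstoD[OF assms, of 1] 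
    by (auto elim!: eventually_mono intro: order_trans[OF abs_Re_le_cmod])
  have "norm (exp z - 1) \<le> exp 1 * norm z" "norm (exp z - 1 - z) \<le> exp 1 * norm (z ^ 2)"
    if "exp \<bar>Re z\<bar> \<le> exp 1" for z
    using Taylor_exp[of z 0] Taylor_exp[of z 1] mult_right_mono[OF that, of "norm z"]
      mult_right_mono[OF that, of "norm z ^ 2"]
    by (auto simp: norm_mult norm_power power2_eq_square algebra_simps)
  thus "(\<lambda>x. exp (f x) - 1) \<in> O[F](f)" "(\<lambda>x. exp (f x) - 1 - f x) \<in> O[F](\<lambda>x. f x ^ 2)"
    using ev by (auto intro!: bigoI[of _ "exp 1"] elim!: eventually_mono)
qed

lemma of_real_tendsto_at_right_0: "((\<lambda>h. of_real h :: complex) \<longlongrightarrow> 0) (at_right 0)"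
  by (auto intro!: tendsto_eq_intros)

lemma of_real_power_bigo:
  assumes "m \<le> n"
  shows "(\<lambda>h. of_real h ^ n :: complex) \<in> O[at_right 0](\<lambda>h. of_real h ^ m)"
proof (rule bigoI[of _ 1])
  show "eventually (\<lambda>h. norm (of_real h ^ n :: complex) \<le> 1 * norm (of_real h ^ m :: complex)) (at_right 0)"
    using eventually_at_right_real[of 0 1]
    by (auto elim!: eventually_mono simp: norm_power power_decreasing assms)
qed

text \<open>The factor \<open>k * h\<close> cancels the pole of \<open>b\<close>, and each remaining
  exponential is \<open>1 + O(h)\<close>.\<close>

lemma amp_b_asymptotic:
  assumes "k \<noteq> 0"
  shows "(\<lambda>h. of_real (k * h) * amp_b q \<beta> (k * h) - of_real (\<Sum>l = - int q..int q. \<beta> l))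
     \<in> O[at_right 0](\<lambda>h. of_real h)"
proof -
  have "(\<lambda>h. \<Sum>l = - int q..int q. (exp (\<i> * of_int l * of_real (k * h)) - 1) * of_real (\<beta> l))
     \<in> O[at_right 0](\<lambda>h. of_real h)"
  proof (rule big_sum_in_bigo)
    fix l
    have "((\<lambda>h. \<i> * of_int l * complex_of_real (k * h)) \<longlongrightarrow> 0) (at_right 0)"
      by (auto intro!: tendsto_eq_intros)
    from exp_minus_one_bigo(1)[OF this]
    have "(\<lambda>h. exp (\<i> * of_int l * of_real (k * h)) - 1) \<in> O[at_right 0](\<lambda>h. (\<i> * of_int l * of_real k) * of_real h :: complex)"
      by (simp add: mult.assoc)
    also have "(\<lambda>h. (\<i> * of_int l * of_real k) * of_real h :: complex) \<in> O[at_right 0](\<lambda>h. of_real h)"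
      by (subst cmult_in_bigo_iff) simp
    finally have "(\<lambda>h. of_real (\<beta> l) * (exp (\<i> * of_int l * of_real (k * h)) - 1)) \<in> O[at_right 0](\<lambda>h. of_real h :: complex)"
      by simp
    thus "(\<lambda>h. (exp (\<i> * of_int l * of_real (k * h)) - 1) * of_real (\<beta> l)) \<in> O[at_right 0](\<lambda>h. of_real h :: complex)"
      by (simp add: mult.commute)
  qed
  moreover have "eventually (\<lambda>h. (\<Sum>l = - int q..int q. (exp (\<i> * of_int l * of_real (k * h)) - 1) * of_real (\<beta> l))
     = of_real (k * h) * amp_b q \<beta> (k * h) - of_real (\<Sum>l = - int q..int q. \<beta> l)) (at_right 0)"
    using eventually_at_right_less[of 0]
    by eventually_elim (use assms in \<open>simp add: amp_b_def sum_subtractf algebra_simps\<close>)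
  ultimately show ?thesis by (subst (asm) landau_o.big.in_cong)
qed

section \<open>Roots of a quadratic with a large linear coefficient\<close>

text \<open>A bootstrap without the root formula: the larger root is at least \<open>F1 / 2\<close>
  in modulus, so \<open>\<mu> = F0 / \<nu>\<close> is \<open>O(h)\<close>. Then
  \<open>\<nu> = - F1 - \<mu>\<close> is known to relative order \<open>h\<close>, and dividing
  \<open>F0\<close> by it again gives the leading term of \<open>\<mu>\<close>.\<close>

lemma quadratic_small_root_asymptotic:
  fixes F0 F1 \<mu> \<nu> :: "real \<Rightarrow> complex"
  assumes F0: "(\<lambda>h. F0 h - f0 * of_real h ^ p) \<in> O[at_right 0](\<lambda>h. of_real h ^ (p + 1))"
    and F1: "(\<lambda>h. of_real h * F1 h - f1) \<in> O[at_right 0](\<lambda>h. of_real h)" and f1: "f1 \<noteq> 0"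
    and sum: "\<And>h. \<mu> h + \<nu> h = - F1 h" and prod: "\<And>h. \<mu> h * \<nu> h = F0 h"
    and le: "\<And>h. norm (\<mu> h) \<le> norm (\<nu> h)"
  shows "(\<lambda>h. \<mu> h - (- f0 / f1) * of_real h ^ (p + 1)) \<in> O[at_right 0](\<lambda>h. of_real h ^ (p + 2))"
    and "((\<lambda>h. of_real h * \<nu> h) \<longlongrightarrow> - f1) (at_right 0)"
proof -
  let ?F = "at_right (0::real)" and ?X = "\<lambda>h::real. of_real h :: complex"
  have lim: "(g \<longlongrightarrow> l) ?F" if "(\<lambda>h. g h - l) \<in> O[?F](?X)" for g l
  proof -
    have "?X \<in> o[?F](\<lambda>_. 1)"
      by (rule smalloI_tendsto) (use of_real_tendsto_at_right_0 in auto)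
    with that have "(\<lambda>h. g h - l) \<in> o[?F](\<lambda>_. 1)" by (rule landau_o.big_small_trans)
    from smalloD_tendsto[OF this] show ?thesis by (simp add: LIM_zero_iff)
  qed
  have "(\<lambda>h. (F0 h - f0 * ?X h ^ p) + f0 * ?X h ^ p) \<in> O[?F](\<lambda>h. 1)"
    using landau_o.big_trans[OF F0 of_real_power_bigo[of 0 "p + 1"]] of_real_power_bigo[of 0 p]
    by (intro sum_in_bigo(1)) simp_all
  hence "F0 \<in> O[?F](\<lambda>h. 1)" by simp
  then obtain C where C: "eventually (\<lambda>h. norm (F0 h) \<le> C) ?F" by (auto elim: landau_o.bigE)
  have "eventually (\<lambda>h. norm f1 / 2 < norm (?X h * F1 h)) ?F"
    using f1 by (intro order_tendstoD(1)[OF tendsto_norm[OF lim[OF F1]]]) simp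
  hence "eventually (\<lambda>h. norm (\<mu> h) \<le> (4 * C / norm f1) * norm (?X h)) ?F"
    using C
  proof eventually_elim
    case (elim h)
    have "norm (F1 h) \<le> norm (\<mu> h) + norm (\<nu> h)"
      using norm_triangle_ineq[of "\<mu> h" "\<nu> h"] by (simp add: sum)
    hence "norm (F1 h) \<le> 2 * norm (\<nu> h)" using le[of h] by simp
    hence "norm (\<mu> h) * (norm (?X h) * norm (F1 h)) \<le> norm (\<mu> h) * (norm (?X h) * (2 * norm (\<nu> h)))"
      by (intro mult_left_mono) auto
    also have "\<dots> = 2 * norm (?X h) * norm (F0 h)" by (simp add: norm_mult flip: prod)
    also have "\<dots> \<le> 2 * norm (?X h) * C" using elim by (intro mult_left_mono) auto
    finally have "norm (\<mu> h) * norm (?X h * F1 h) \<le> 2 * norm (?X h) * C" by (simp add: norm_mult)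
    moreover have "norm (\<mu> h) * (norm f1 / 2) \<le> norm (\<mu> h) * norm (?X h * F1 h)"
      using elim by (intro mult_left_mono) auto
    ultimately have "norm (\<mu> h) * (norm f1 / 2) \<le> 2 * norm (?X h) * C" by linarith
    thus ?case using f1 by (simp add: field_simps)
  qed
  hence \<mu>: "\<mu> \<in> O[?F](?X)" by (rule bigoI)
  \<comment> \<open>The rescaled large root: \<open>H\<close> tends to \<open>f1\<close>, and
    \<open>\<mu> = - h * F0 / H\<close>.\<close>
  define H where "H h = - (?X h * \<nu> h)" for h
  have \<nu>: "\<nu> h = - F1 h - \<mu> h" for h using sum[of h] by (simp add: algebra_simps)
  have "(\<lambda>h. ?X h * \<mu> h) \<in> O[?F](?X)"
    using landau_o.big.mult[OF of_real_power_bigo[of 0 1] \<mu>] by simp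
  hence "(\<lambda>h. (?X h * F1 h - f1) + ?X h * \<mu> h) \<in> O[?F](?X)" by (intro sum_in_bigo F1)
  hence H: "(\<lambda>h. H h - f1) \<in> O[?F](?X)" by (simp add: H_def \<nu> algebra_simps)
  have Hlim: "(H \<longlongrightarrow> f1) ?F" by (rule lim[OF H])
  from tendsto_minus[OF this] show "((\<lambda>h. ?X h * \<nu> h) \<longlongrightarrow> - f1) ?F" by (simp add: H_def)
  \<comment> \<open>Over the common denominator \<open>f1 * H\<close>, the error of
    \<open>\<mu>\<close> has as numerator the difference of this term and the next; the mixed terms
    \<open>f0 * f1 * h ^ (p + 1)\<close> cancel.\<close>
  have "(\<lambda>h. f0 * ?X h ^ (p + 1) * (H h - f1)) \<in> O[?F](\<lambda>h. ?X h ^ (p + 1) * ?X h)"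
    by (intro landau_o.big.mult H) simp
  moreover have "(\<lambda>h. f1 * ?X h * (F0 h - f0 * ?X h ^ p)) \<in> O[?F](\<lambda>h. ?X h * ?X h ^ (p + 1))"
    by (intro landau_o.big.mult F0) simp
  ultimately have num: "(\<lambda>h. f0 * ?X h ^ (p + 1) * (H h - f1) - f1 * ?X h * (F0 h - f0 * ?X h ^ p))
      \<in> O[?F](\<lambda>h. ?X h ^ (p + 2))"
    by (intro sum_in_bigo) (simp_all add: mult_ac)
  have "(\<lambda>h. 1 / (f1 * H h)) \<in> O[?F](\<lambda>h. 1)"
    by (rule bigoI_tendsto[where c = "1 / (f1 * f1)"])
       (use f1 in \<open>auto intro!: tendsto_eq_intros Hlim\<close>)
  from landau_o.big.mult[OF num this]
  have "(\<lambda>h. (f0 * ?X h ^ (p + 1) * (H h - f1) - f1 * ?X h * (F0 h - f0 * ?X h ^ p)) * (1 / (f1 * H h)))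
      \<in> O[?F](\<lambda>h. ?X h ^ (p + 2))" by simp
  moreover have "eventually (\<lambda>h. (f0 * ?X h ^ (p + 1) * (H h - f1) - f1 * ?X h * (F0 h - f0 * ?X h ^ p)) * (1 / (f1 * H h))
     = \<mu> h - (- f0 / f1) * ?X h ^ (p + 1)) ?F"
    using tendsto_imp_eventually_ne[OF Hlim f1]
  proof eventually_elim
    case (elim h)
    have "\<mu> h * H h = - (?X h * F0 h)" by (simp add: H_def flip: prod)
    hence "\<mu> h = - (?X h * F0 h) / H h" using elim by (simp add: field_simps)
    thus ?case using elim f1 by (simp add: field_simps)
  qed
  ultimately show "(\<lambda>h. \<mu> h - (- f0 / f1) * ?X h ^ (p + 1)) \<in> O[?F](\<lambda>h. ?X h ^ (p + 2))"
    by (subst (asm) landau_o.big.in_cong)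
qed

text \<open>The sign in front of the square root does not tell which root is small, so the roots are
  labelled by modulus.\<close>

lemma quadratic_roots_exist:
  fixes F0 F1 :: complex
  obtains \<mu> \<nu> where "\<mu> + \<nu> = - F1" "\<mu> * \<nu> = F0" "norm \<mu> \<le> norm \<nu>"
proof -
  define d where "d = csqrt (F1\<^sup>2 - 4 * F0)"
  define m n where "m = (- F1 + d) / 2" and "n = (- F1 - d) / 2"
  have "d * d = F1 * F1 - 4 * F0"
    using power2_csqrt[of "F1\<^sup>2 - 4 * F0"] by (simp add: d_def power2_eq_square)
  hence "m * n = F0" by (simp add: m_def n_def field_simps)
  moreover have "m + n = - F1" by (simp add: m_def n_def field_simps)
  ultimately show ?thesis
    using that[of m n] that[of n m] by (cases "norm m \<le> norm n") (auto simp: mult.commute add.commute)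
qed

section \<open>Expansion of the superposition of slow and parasitic mode\<close>

text \<open>
  The nodal coefficient jumps at \<open>t = 0\<close>: the parasitic mode enters \<open>N\<close> with weight of order \<open>h\<^sup>m\<close>,
  cancelling the slow mode there, and is negligible at every later time.
\<close>
lemma two_mode_asymptotic:
  fixes \<mu> \<nu> :: "real \<Rightarrow> complex" and t :: real
  defines "E \<equiv> \<lambda>h. exp (\<nu> h * of_real t)"
  defines "U \<equiv> \<lambda>h. (\<nu> h * exp (\<mu> h * of_real t) - \<mu> h * E h) / (\<nu> h - \<mu> h)"
  assumes \<mu>: "(\<lambda>h. \<mu> h - d * of_real h ^ m) \<in> O[at_right 0](\<lambda>h. of_real h ^ (m + 1))" and m: "m \<ge> 1"
    and \<nu>: "((\<lambda>h. of_real h * \<nu> h) \<longlongrightarrow> - of_real \<kappa>) (at_right 0)" and \<kappa>: "\<kappa> > 0" and t: "t \<ge> 0"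
  shows "eventually (\<lambda>h. \<nu> h \<noteq> \<mu> h) (at_right 0)"
    and "(\<lambda>h. U h - 1 - d * of_real t * of_real h ^ m) \<in> O[at_right 0](\<lambda>h. of_real h ^ (m + 1))"
    and "(\<lambda>h. U h + s * \<mu> h * (U h - E h) - 1 - (if t = 0 then 0 else d * of_real t + s * d) * of_real h ^ m)
        \<in> O[at_right 0](\<lambda>h. of_real h ^ (m + 1))"
proof -
  let ?F = "at_right (0::real)" and ?X = "\<lambda>h::real. of_real h :: complex"
  have "(\<lambda>h. (\<mu> h - d * ?X h ^ m) + d * ?X h ^ m) \<in> O[?F](\<lambda>h. ?X h ^ m)"
    using landau_o.big_trans[OF \<mu> of_real_power_bigo[of m "m + 1"]]
    by (intro sum_in_bigo(1)) simp_all
  hence \<mu>O: "\<mu> \<in> O[?F](\<lambda>h. ?X h ^ m)" by simp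
  have "(\<lambda>h. ?X h ^ m) \<in> o[?F](\<lambda>_. 1)"
    by (rule smalloI_tendsto) (use m in \<open>auto intro!: tendsto_eq_intros\<close>)
  from smalloD_tendsto[OF landau_o.big_small_trans[OF \<mu>O this]]
  have \<mu>0: "(\<mu> \<longlongrightarrow> 0) ?F" by simp
  have diff: "((\<lambda>h. ?X h * (\<nu> h - \<mu> h)) \<longlongrightarrow> - of_real \<kappa>) ?F"
    using tendsto_diff[OF \<nu> tendsto_mult[OF of_real_tendsto_at_right_0 \<mu>0]]
    by (simp add: algebra_simps)
  show ne: "eventually (\<lambda>h. \<nu> h \<noteq> \<mu> h) ?F"
    using tendsto_imp_eventually_ne[OF diff, of 0] \<kappa> by (auto elim: eventually_mono)
  have hpos: "eventually (\<lambda>h. h > 0) (at_right (0::real))" by (rule eventually_at_right_less)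
  have "((\<lambda>h. 1 / (?X h * (\<nu> h - \<mu> h))) \<longlongrightarrow> 1 / (- of_real \<kappa>)) ?F"
    using \<kappa> by (intro tendsto_divide diff) auto
  moreover have "eventually (\<lambda>h. 1 / (?X h * (\<nu> h - \<mu> h)) = (1 / (\<nu> h - \<mu> h)) / ?X h) ?F"
    by (auto intro!: always_eventually)
  \<comment> \<open>The spectral gap grows like \<open>\<kappa> / h\<close>; this makes the
    parasitic weight \<open>\<mu> / (\<nu> - \<mu>)\<close> in \<open>U\<close> one order smaller
    than \<open>\<mu>\<close>.\<close>
  ultimately have inv: "(\<lambda>h. 1 / (\<nu> h - \<mu> h)) \<in> O[?F](?X)"
    by (intro bigoI_tendsto[where c = "1 / (- of_real \<kappa>)"])
       (auto simp: tendsto_cong intro: eventually_mono[OF hpos])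
  have Re: "eventually (\<lambda>h. Re (\<nu> h) < - \<kappa> / (2 * h)) ?F"
    using order_tendstoD(2)[OF tendsto_Re[OF \<nu>], of "- \<kappa> / 2", simplified, OF \<kappa>] hpos
    by eventually_elim (simp add: field_simps)
  have E1: "E \<in> O[?F](\<lambda>_. 1)"
  proof (rule bigoI[of _ 1])
    show "eventually (\<lambda>h. norm (E h) \<le> 1 * norm (1::complex)) ?F"
      using Re hpos
    proof eventually_elim
      case (elim h)
      have "- \<kappa> / (2 * h) \<le> 0" using elim \<kappa> by simp
      hence "Re (\<nu> h) \<le> 0" using elim by linarith
      thus ?case using t by (simp add: E_def mult_nonpos_nonneg)
    qed
  qed
  \<comment> \<open>Exponential decay is more than is needed here:
    \<open>exp (- x) \<le> 1 / x\<close> at \<open>x = t * \<kappa> / (2 * h)\<close> already yields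
    \<open>O(h)\<close>.\<close>
  have E2: "E \<in> O[?F](?X)" if t0: "t > 0"
  proof (rule bigoI[of _ "2 / (t * \<kappa>)"])
    show "eventually (\<lambda>h. norm (E h) \<le> 2 / (t * \<kappa>) * norm (?X h)) ?F"
      using Re hpos
    proof eventually_elim
      case (elim h)
      let ?x = "t * \<kappa> / (2 * h)"
      have x: "?x > 0" using elim \<kappa> t0 by simp
      have "Re (\<nu> h) * t \<le> (- \<kappa> / (2 * h)) * t" using elim t by (intro mult_right_mono) auto
      hence "norm (E h) \<le> exp (- ?x)" by (simp add: E_def mult.commute)
      also have "exp (- ?x) \<le> 1 / ?x"
        unfolding exp_minus inverse_eq_divide
        by (rule frac_le[OF zero_le_one order_refl x])
           (use exp_ge_add_one_self[of ?x] in linarith)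
      finally show ?case using elim by simp
    qed
  qed
  have "((\<lambda>h. \<mu> h * of_real t) \<longlongrightarrow> 0) ?F" using \<mu>0 by (auto intro!: tendsto_eq_intros)
  note ex = exp_minus_one_bigo[OF this]
  have \<mu>t: "(\<lambda>h. \<mu> h * of_real t) \<in> O[?F](\<lambda>h. ?X h ^ m)"
    using landau_o.big.mult[OF \<mu>O bigo_const[of "of_real t"]] by simp
  have ex1: "(\<lambda>h. exp (\<mu> h * of_real t) - 1) \<in> O[?F](\<lambda>_. 1)"
    using landau_o.big_trans[OF landau_o.big_trans[OF ex(1) \<mu>t] of_real_power_bigo[of 0 m]] by simp
  have "(\<lambda>h. (\<mu> h * of_real t)^2) \<in> O[?F](\<lambda>h. (?X h ^ m)^2)"
    by (intro landau_o.big_power \<mu>t)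
  \<comment> \<open>\<open>2 * m \<ge> m + 1\<close> because \<open>m \<ge> 1\<close>.\<close>
  also have "(\<lambda>h. (?X h ^ m)^2) \<in> O[?F](\<lambda>h. ?X h ^ (m + 1))"
    unfolding power_mult[symmetric] using m by (intro of_real_power_bigo) simp
  finally have ex2: "(\<lambda>h. exp (\<mu> h * of_real t) - 1 - \<mu> h * of_real t) \<in> O[?F](\<lambda>h. ?X h ^ (m + 1))"
    by (rule landau_o.big_trans[OF ex(2)])
  have "(\<lambda>h. (exp (\<mu> h * of_real t) - 1) + 1 - E h) \<in> O[?F](\<lambda>_. 1)"
    by (intro sum_in_bigo ex1 E1) simp
  hence bd: "(\<lambda>h. exp (\<mu> h * of_real t) - E h) \<in> O[?F](\<lambda>_. 1)" by simp
  have rest: "(\<lambda>h. \<mu> h * (1 / (\<nu> h - \<mu> h)) * (exp (\<mu> h * of_real t) - E h)) \<in> O[?F](\<lambda>h. ?X h ^ (m + 1))"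
    using landau_o.big.mult[OF landau_o.big.mult[OF \<mu>O inv] bd] by (simp add: mult.commute)
  have \<mu>': "(\<lambda>h. of_real t * (\<mu> h - d * ?X h ^ m)) \<in> O[?F](\<lambda>h. ?X h ^ (m + 1))"
    using \<mu> by simp
  have "(\<lambda>h. (exp (\<mu> h * of_real t) - 1 - \<mu> h * of_real t) + of_real t * (\<mu> h - d * ?X h ^ m)
      + \<mu> h * (1 / (\<nu> h - \<mu> h)) * (exp (\<mu> h * of_real t) - E h)) \<in> O[?F](\<lambda>h. ?X h ^ (m + 1))"
    by (intro sum_in_bigo ex2 \<mu>' rest)
  moreover have "eventually (\<lambda>h. (exp (\<mu> h * of_real t) - 1 - \<mu> h * of_real t) + of_real t * (\<mu> h - d * ?X h ^ m)
      + \<mu> h * (1 / (\<nu> h - \<mu> h)) * (exp (\<mu> h * of_real t) - E h) = U h - 1 - d * of_real t * of_real h ^ m) ?F"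
    using ne
  proof eventually_elim
    case (elim h)
    \<comment> \<open>\<open>\<nu> / (\<nu> - \<mu>) = 1 + \<mu> / (\<nu> - \<mu>)\<close> splits
      off the slow mode with weight exactly 1.\<close>
    hence "U h = exp (\<mu> h * of_real t) + \<mu> h * (1 / (\<nu> h - \<mu> h)) * (exp (\<mu> h * of_real t) - E h)"
      by (simp add: U_def field_simps)
    thus ?case by (simp add: algebra_simps)
  qed
  ultimately show U: "(\<lambda>h. U h - 1 - d * of_real t * ?X h ^ m) \<in> O[?F](\<lambda>h. ?X h ^ (m + 1))"
    by (subst (asm) landau_o.big.in_cong)
  show "(\<lambda>h. U h + s * \<mu> h * (U h - E h) - 1 - (if t = 0 then 0 else d * of_real t + s * d) * ?X h ^ m)
        \<in> O[?F](\<lambda>h. ?X h ^ (m + 1))"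
  \<comment> \<open>At \<open>t = 0\<close> both \<open>U\<close> and \<open>E\<close> equal 1 and
    nothing is left of the error. For \<open>t > 0\<close>, \<open>U - E\<close> tends to 1, so the
    extra term contributes \<open>s * d\<close>.\<close>
  proof (cases "t = 0")
    case True
    have "eventually (\<lambda>h. 0 = U h + s * \<mu> h * (U h - E h) - 1 - (if t = 0 then 0 else d * of_real t + s * d) * ?X h ^ m) ?F"
      using ne by eventually_elim (simp add: True U_def E_def)
    from landau_o.big.in_cong[OF this] show ?thesis by simp
  next
    case False
    have "(\<lambda>h. (U h - 1 - d * of_real t * ?X h ^ m) + d * of_real t * ?X h ^ m - E h) \<in> O[?F](?X)"
      using landau_o.big_trans[OF U of_real_power_bigo[of 1 "m + 1"]]
        of_real_power_bigo[of 1 m] E2 m t False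
      by (intro sum_in_bigo(2)[OF sum_in_bigo(1)]) simp_all
    hence "(\<lambda>h. U h - E h - 1) \<in> O[?F](?X)" by (simp add: algebra_simps)
    hence "(\<lambda>h. s * \<mu> h * (U h - E h - 1)) \<in> O[?F](\<lambda>h. ?X h ^ m * ?X h)"
      using \<mu>O by (intro landau_o.big.mult) simp_all
    moreover have "(\<lambda>h. s * (\<mu> h - d * ?X h ^ m)) \<in> O[?F](\<lambda>h. ?X h ^ (m + 1))" using \<mu> by simp
    ultimately have "(\<lambda>h. (U h - 1 - d * of_real t * ?X h ^ m) + s * \<mu> h * (U h - E h - 1)
        + s * (\<mu> h - d * ?X h ^ m)) \<in> O[?F](\<lambda>h. ?X h ^ (m + 1))"
      by (intro sum_in_bigo U) (simp_all add: mult.commute)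
    thus ?thesis using False by (simp add: algebra_simps)
  qed
qed

section \<open>Assembling the order of the scheme\<close>

theorem theorem2p8:
  fixes q p :: nat and \<alpha> \<beta> :: "int \<Rightarrow> real" and c T :: real
  assumes "q \<ge> 1" and "p \<ge> 1" and "T > 0"
    and "fdfv_op_order q \<alpha> \<beta> p"
    and "(\<Sum>l = - int q..int q. \<beta> l) \<noteq> 0"
    and "c \<noteq> 0"
    and "c * (\<Sum>l = - int q..int q. \<beta> l) > 0"
  shows "fdfv_scheme_order_at_least q \<alpha> \<beta> c T (p + 1)"
  unfolding fdfv_scheme_order_at_least_def
proof (intro allI impI)
  fix k :: real assume k: "k \<noteq> 0"
  let ?F = "at_right (0::real)" and ?X = "\<lambda>h::real. of_real h :: complex"
  define \<kappa> where "\<kappa> = c * (\<Sum>l = - int q..int q. \<beta> l)"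
  define P where "P = complex_of_real (c * k)"
  have \<kappa>: "\<kappa> > 0" using assms by (simp add: \<kappa>_def)
  have P: "P \<noteq> 0" using assms k by (simp add: P_def)
  define a b where "a h = amp_a q \<alpha> (k * h)" and "b h = amp_b q \<beta> (k * h)" for h
  \<comment> \<open>Inserting \<open>\<lambda> = \<mu> - \<i> * P\<close> into
    \<open>\<lambda>^2 + P * b * \<lambda> - \<i> * P^2 * a = 0\<close> gives these coefficients. In
    \<open>F0\<close> the leading part cancels, since \<open>1 + \<i> * \<i> = 0\<close>.\<close>
  define F0 where "F0 h = - P\<^sup>2 * (1 + \<i> * (a h + b h))" for h
  define F1 where "F1 h = P * b h - 2 * \<i> * P" for h
  obtain C where C: "(\<lambda>h. a h + b h - (\<i> + C * ?X h ^ p)) \<in> O[?F](\<lambda>h. ?X h ^ (p + 1))"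
    using fdfv_op_order_symbol[OF assms(4) k] unfolding a_def b_def by blast
  define f0 where "f0 = - P\<^sup>2 * \<i> * C"
  have "(\<lambda>h. (- P\<^sup>2 * \<i>) * (a h + b h - (\<i> + C * ?X h ^ p))) \<in> O[?F](\<lambda>h. ?X h ^ (p + 1))"
    using C by (subst cmult_in_bigo_iff) simp
  hence F0: "(\<lambda>h. F0 h - f0 * ?X h ^ p) \<in> O[?F](\<lambda>h. ?X h ^ (p + 1))"
    by (simp add: F0_def f0_def algebra_simps)
  have "(\<lambda>h. of_real c * (of_real (k * h) * b h - of_real (\<Sum>l = - int q..int q. \<beta> l)) - (2 * \<i> * P) * ?X h)
      \<in> O[?F](?X)"
    using amp_b_asymptotic[OF k, of q \<beta>] unfolding b_def
    by (intro sum_in_bigo) simp_all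
  hence F1: "(\<lambda>h. ?X h * F1 h - of_real \<kappa>) \<in> O[?F](?X)"
    by (simp add: F1_def P_def \<kappa>_def algebra_simps)
  \<comment> \<open>The roots are chosen separately for each \<open>h\<close>; no continuity in
    \<open>h\<close> is claimed.\<close>
  have "\<exists>\<mu> \<nu>. \<mu> + \<nu> = - F1 h \<and> \<mu> * \<nu> = F0 h \<and> norm \<mu> \<le> norm \<nu>" for h
    using quadratic_roots_exist by metis
  then obtain \<mu> \<nu> where sum: "\<And>h. \<mu> h + \<nu> h = - F1 h" and prod: "\<And>h. \<mu> h * \<nu> h = F0 h"
    and le: "\<And>h. norm (\<mu> h) \<le> norm (\<nu> h)" by metis
  define d where "d = - f0 / of_real \<kappa>"
  note roots = quadratic_small_root_asymptotic[OF F0 F1 _ sum prod le, folded d_def]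
  have \<mu>: "(\<lambda>h. \<mu> h - d * ?X h ^ (p + 1)) \<in> O[?F](\<lambda>h. ?X h ^ (p + 1 + 1))"
    and \<nu>: "((\<lambda>h. ?X h * \<nu> h) \<longlongrightarrow> - of_real \<kappa>) ?F"
    using roots \<kappa> by simp_all
  \<comment> \<open>Division by \<open>k ^ (p + 1)\<close> converts powers of \<open>h\<close> into
    powers of \<open>k * h\<close>. The extra \<open>\<i> / P * d\<close> in \<open>cn\<close> is
    the slow-mode correction of \<open>N\<close> relative to \<open>A\<close>, absent at
    \<open>t = 0\<close> where \<open>N = 1\<close> exactly.\<close>
  define ca where "ca t = d * of_real t / of_real k ^ (p + 1)" for t
  define cn where "cn t = (if t = 0 then 0 else d * of_real t + \<i> / P * d) / of_real k ^ (p + 1)" for t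
  show "\<exists>ca cn :: real \<Rightarrow> complex.
        \<forall>A N :: real \<Rightarrow> real \<Rightarrow> complex.
          (\<forall>h>0. amplitudes q \<alpha> \<beta> c T k h (A h) (N h)) \<longrightarrow>
          (\<forall>t\<in>{0..T}.
            (\<exists>R \<in> O[at_right 0](\<lambda>h. of_real (k * h) ^ (p + 1 + 1)). \<forall>h>0.
               A h t = exp (- \<i> * of_real c * of_real k * of_real t)
                        * (1 + ca t * of_real (k * h) ^ (p + 1) + R h)) \<and>
            (\<exists>R \<in> O[at_right 0](\<lambda>h. of_real (k * h) ^ (p + 1 + 1)). \<forall>h>0.
               N h t = exp (- \<i> * of_real c * of_real k * of_real t)
                        * (1 + cn t * of_real (k * h) ^ (p + 1) + R h)))"
  proof (rule exI[of _ ca], rule exI[of _ cn], intro allI impI ballI)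
    fix A N :: "real \<Rightarrow> real \<Rightarrow> complex" and t
    assume amp: "\<forall>h>0. amplitudes q \<alpha> \<beta> c T k h (A h) (N h)" and t: "t \<in> {0..T}"
    define W where "W = exp (\<i> * P * of_real t)"
    define E where "E h = exp (\<nu> h * of_real t)" for h
    define U where "U h = (\<nu> h * exp (\<mu> h * of_real t) - \<mu> h * E h) / (\<nu> h - \<mu> h)" for h
    have W: "exp (- \<i> * of_real c * of_real k * of_real t) * W = 1"
      by (simp add: W_def P_def exp_add[symmetric])
    \<comment> \<open>The expansion must hold for every \<open>h > 0\<close>, while the mode formula
      \<open>V\<close> is available only for small \<open>h\<close>. Hence \<open>R\<close> is taken
      as the exact remainder of \<open>G\<close>, which eventually agrees with that of
      \<open>V\<close>.\<close>
    have rem: "\<exists>R \<in> O[?F](\<lambda>h. of_real (k * h) ^ (p + 1 + 1)). \<forall>h>0.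
        G h = exp (- \<i> * of_real c * of_real k * of_real t) * (1 + g / of_real k ^ (p + 1) * of_real (k * h) ^ (p + 1) + R h)"
      if V: "(\<lambda>h. V h - 1 - g * ?X h ^ (p + 1)) \<in> O[?F](\<lambda>h. ?X h ^ (p + 1 + 1))"
        and G: "eventually (\<lambda>h. V h = G h * W) ?F" for V G g
    proof (rule bexI)
      let ?R = "\<lambda>h. G h * W - 1 - g * ?X h ^ (p + 1)"
      have "eventually (\<lambda>h. V h - 1 - g * ?X h ^ (p + 1) = ?R h) ?F" using G by eventually_elim simp
      with V have "?R \<in> O[?F](\<lambda>h. ?X h ^ (p + 1 + 1))" by (subst (asm) landau_o.big.in_cong)
      also have "(\<lambda>h. ?X h ^ (p + 1 + 1)) \<in> O[?F](\<lambda>h. of_real k ^ (p + 1 + 1) * ?X h ^ (p + 1 + 1))"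
        using k by (subst landau_o.big.cmult) simp_all
      finally show "?R \<in> O[?F](\<lambda>h. of_real (k * h) ^ (p + 1 + 1))"
        unfolding of_real_mult power_mult_distrib .
      have "exp (- \<i> * of_real c * of_real k * of_real t) * (1 + g / of_real k ^ (p + 1) * of_real (k * h) ^ (p + 1) + ?R h)
         = (exp (- \<i> * of_real c * of_real k * of_real t) * W) * G h" for h
        using k by (simp add: power_mult_distrib)
      thus "\<forall>h>0. G h = exp (- \<i> * of_real c * of_real k * of_real t) * (1 + g / of_real k ^ (p + 1) * of_real (k * h) ^ (p + 1) + ?R h)"
        unfolding W by simp
    qed
    have t0: "t \<ge> 0" using t by simp
    note asym = two_mode_asymptotic[OF \<mu> _ \<nu> \<kappa> t0, folded E_def, folded U_def]
    have ne: "eventually (\<lambda>h. \<nu> h \<noteq> \<mu> h) ?F" using asym by simp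
    have AN: "U h = A h t * W" "U h + \<i> / P * \<mu> h * (U h - E h) = N h t * W" if h: "h > 0" "\<nu> h \<noteq> \<mu> h" for h
    proof -
      have s: "\<mu> h + \<nu> h = 2 * \<i> * P - P * b h" using sum[of h] by (simp add: F1_def)
      note mode = amplitudes_mode[OF amp[rule_format, OF h(1)] _ _ t, folded P_def a_def b_def, folded F0_def W_def]
      have 1: "((\<i> * P - \<mu> h) * A h t - \<i> * P * N h t) * W = - \<mu> h * E h"
        unfolding E_def using s prod by (intro mode) auto
      \<comment> \<open>The hypotheses of \<open>amplitudes_mode\<close> are symmetric in the two
        roots, so exchanging them gives a second relation. The difference of the two isolates
        \<open>A\<close>, and the first then yields \<open>N\<close>, with
        \<open>- 1 / (\<i> * P) = \<i> / P\<close>.\<close>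
      have 2: "((\<i> * P - \<nu> h) * A h t - \<i> * P * N h t) * W = - \<nu> h * exp (\<mu> h * of_real t)"
        using s prod by (intro mode) (auto simp: add.commute mult.commute)
      have "(\<nu> h - \<mu> h) * (A h t * W) = ((\<i> * P - \<mu> h) * A h t - \<i> * P * N h t) * W
          - ((\<i> * P - \<nu> h) * A h t - \<i> * P * N h t) * W" by (simp add: algebra_simps)
      also have "\<dots> = \<nu> h * exp (\<mu> h * of_real t) - \<mu> h * E h" unfolding 1 2 by simp
      finally show U: "U h = A h t * W" using h by (simp add: U_def field_simps)
      have "\<i> * P * (N h t * W) = (\<i> * P - \<mu> h) * (A h t * W) - ((\<i> * P - \<mu> h) * A h t - \<i> * P * N h t) * W"
        by (simp add: algebra_simps)
      also have "\<dots> = \<i> * P * (U h + \<i> / P * \<mu> h * (U h - E h))"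
        unfolding 1 U using P by (simp add: algebra_simps)
      finally show "U h + \<i> / P * \<mu> h * (U h - E h) = N h t * W" using P by simp
    qed
    have "eventually (\<lambda>h. h > 0 \<and> \<nu> h \<noteq> \<mu> h) ?F"
      using ne eventually_at_right_less by (rule eventually_conj[rotated])
    hence ev: "eventually (\<lambda>h. U h = A h t * W) ?F"
      "eventually (\<lambda>h. U h + \<i> / P * \<mu> h * (U h - E h) = N h t * W) ?F"
      using AN by (auto elim!: eventually_mono)
    show "(\<exists>R \<in> O[?F](\<lambda>h. of_real (k * h) ^ (p + 1 + 1)). \<forall>h>0.
               A h t = exp (- \<i> * of_real c * of_real k * of_real t)
                        * (1 + ca t * of_real (k * h) ^ (p + 1) + R h)) \<and>
            (\<exists>R \<in> O[?F](\<lambda>h. of_real (k * h) ^ (p + 1 + 1)). \<forall>h>0.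
               N h t = exp (- \<i> * of_real c * of_real k * of_real t)
                        * (1 + cn t * of_real (k * h) ^ (p + 1) + R h))"
      unfolding ca_def cn_def
      by (intro conjI rem[OF asym(2) ev(1)] rem[OF asym(3) ev(2)]) simp_all
  qed
qed

end
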